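(* Let $(\boldsymbol{\Sigma},\sigma)$ be a finitely primitive Markov subshift on the countable alphabet $\mathbb Z_+$, and let $A:\boldsymbol{\Sigma}\to\mathbb R$ be a bounded above, coercive and locally H\"older continuous potential. Then there exists an integer $\hat I > I_{\mathbb F}$ such that $$\beta_A=\max_{\mu\in\mathcal M_\sigma,\ \operatorname{supp}\mu\subseteq\Sigma_{\hat I}}\int A\,d\mu .$$ In particular, $A$-maximizing probabilities exist. Furthermore, there exists a compact $\sigma$-invariant set $\Omega\subseteq\Sigma_{\hat I}$ such that a measure $\mu\in\mathcal M_\sigma$ is $A$-maximizing if and only if $\operatorname{supp}\mu\subseteq\Omega$.
   Context: Let $\mathbf M:\mathbb Z_+\times\mathbb Z_+\to\{0,1\}$ be a transition matrix ($\mathbb Z_+$ = nonnegative integers). Put $\mathcal B_0=\{i:\mathbf M(i,j)=1\text{ for some }j\in\mathbb Z_+\}$ and $\mathcal B_n=\{i:\mathbf M(i,j)=1\text{ for some }j\in\mathcal B_{n-1}\}$ for $n>0$. $\mathbf M$ is primitive if there exist a subset $\mathbb F\subseteq\mathbb Z_+$ and an integer $K_0\ge 0$ such that for every pair $i,j\in\bigcap_{n\ge0}\mathcal B_n$ there are $\ell_1,\dots,\ell_{K_0}\in\mathbb F$ with $\mathbf M(i,\ell_1)\mathbf M(\ell_1,\ell_2)\cdots\mathbf M(\ell_{K_0},j)=1$; it is finitely primitive if moreover $\mathbb F$ is finite. $\boldsymbol{\Sigma}=\{\mathbf x=(x_0,x_1,\dots)\in\mathbb Z_+^{\mathbb Z_+}:\mathbf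 M(x_j,x_{j+1})=1\ \forall j\}$, with the metric $d(\mathbf x,\mathbf y)=\lambda^{k}$, $k=\min\{j:x_j\ne y_j\}$, for a fixed $\lambda\in(0,1)$; $\sigma$ is the left shift. The subshift is called (finitely) primitive if $\mathbf M$ is. $[i]=\{\mathbf x\in\boldsymbol\Sigma:x_0=i\}$. $\mathcal M_\sigma$ is the set of $\sigma$-invariant Borel probabilities on $\boldsymbol\Sigma$. For continuous bounded above $A$, $\beta_A=\sup_{\mu\in\mathcal M_\sigma}\int A\,d\mu$, and $\mu$ is $A$-maximizing if it attains this supremum. $\mathrm{Var}_k(A)=\sup\{A(\mathbf x)-A(\mathbf y): d(\mathbf x,\mathbf y)\le\lambda^k\}$; $A$ is locally H\"older continuous if there is $H_A>0$ with $\mathrm{Var}_k(A)\le H_A\lambda^k$ for all $k\ge1$. $A$ is coercive if $\lim_{i\to+\infty}\sup A|_{[i]}=-\infty$. For an integer $I\ge0$, $\Sigma_I=\{\mathbf x\in\{0,\dots,I\}^{\mathbb Z_+}:\mathbf M(x_j,x_{j+1})=1\ \forall j\}$ (a compact $\sigma$-invariant subset of $\boldsymbol\Sigma$). When $\mathbb F$ is finite, $I_{\mathbb F}=\max\mathbb F$. *)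

theory Defs
  imports "HOL-Probability.Probability"
begin

text \<open>Transition matrix M : Z+ x Z+ -> {0,1} is modelled as M :: nat => nat => bool.
  Points of the full shift are sequences nat => nat; the Borel structure is that of the
  product topology (which coincides with the topology of the metric d(x,y) = lambda^k).\<close>

fun Bset :: "(nat \<Rightarrow> nat \<Rightarrow> bool) \<Rightarrow> nat \<Rightarrow> nat set" where
  "Bset M 0 = {i. \<exists>j. M i j}"
| "Bset M (Suc n) = {i. \<exists>j \<in> Bset M n. M i j}"

definition core :: "(nat \<Rightarrow> nat \<Rightarrow> bool) \<Rightarrow> nat set" where
  "core M = (\<Inter>n. Bset M n)"

definition primitive_wrt :: "(nat \<Rightarrow> nat \<Rightarrow> bool) \<Rightarrow> nat set \<Rightarrow> nat \<Rightarrow> bool" where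
  "primitive_wrt M F K0 \<longleftrightarrow>
     (\<forall>i \<in> core M. \<forall>j \<in> core M. \<exists>l :: nat \<Rightarrow> nat.
        l 0 = i \<and> l (Suc K0) = j \<and> (\<forall>k \<in> {1..K0}. l k \<in> F) \<and>
        (\<forall>k \<le> K0. M (l k) (l (Suc k))))"

definition finitely_primitive :: "(nat \<Rightarrow> nat \<Rightarrow> bool) \<Rightarrow> bool" where
  "finitely_primitive M \<longleftrightarrow> (\<exists>F K0. finite F \<and> primitive_wrt M F K0)"

definition SigmaM :: "(nat \<Rightarrow> nat \<Rightarrow> bool) \<Rightarrow> (nat \<Rightarrow> nat) set" where
  "SigmaM M = {x. \<forall>j. M (x j) (x (Suc j))}"

definition SigmaI :: "(nat \<Rightarrow> nat \<Rightarrow> bool) \<Rightarrow> nat \<Rightarrow> (nat \<Rightarrow> nat) set" where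
  "SigmaI M I = {x \<in> SigmaM M. \<forall>j. x j \<le> I}"

definition shift :: "(nat \<Rightarrow> nat) \<Rightarrow> (nat \<Rightarrow> nat)" where
  "shift x = (\<lambda>n. x (Suc n))"

definition inv_probs :: "(nat \<Rightarrow> nat \<Rightarrow> bool) \<Rightarrow> (nat \<Rightarrow> nat) measure set" where
  "inv_probs M = {\<mu>. sets \<mu> = sets (restrict_space borel (SigmaM M)) \<and> prob_space \<mu> \<and>
      (\<forall>B \<in> sets \<mu>. emeasure \<mu> (shift -` B \<inter> SigmaM M) = emeasure \<mu> B)}"

definition supp :: "(nat \<Rightarrow> nat) measure \<Rightarrow> (nat \<Rightarrow> nat) set" where
  "supp \<mu> = {x \<in> space \<mu>. \<forall>U. open U \<longrightarrow> x \<in> U \<longrightarrow> emeasure \<mu> (U \<inter> space \<mu>) > 0}"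

text \<open>Extended integral of a potential bounded above: the Lebesgue integral if integrable,
  and -infinity otherwise (for a measurable function bounded above, non-integrability
  means the integral is -infinity).\<close>
definition integ :: "(nat \<Rightarrow> nat) measure \<Rightarrow> ((nat \<Rightarrow> nat) \<Rightarrow> real) \<Rightarrow> ereal" where
  "integ \<mu> A = (if integrable \<mu> A then ereal (\<integral>x. A x \<partial>\<mu>) else -\<infinity>)"

definition beta :: "(nat \<Rightarrow> nat \<Rightarrow> bool) \<Rightarrow> ((nat \<Rightarrow> nat) \<Rightarrow> real) \<Rightarrow> ereal" where
  "beta M A = (SUP \<mu> \<in> inv_probs M. integ \<mu> A)"

definition maximizing :: "(nat \<Rightarrow> nat \<Rightarrow> bool) \<Rightarrow> ((nat \<Rightarrow> nat) \<Rightarrow> real) \<Rightarrow> (nat \<Rightarrow> nat) measure \<Rightarrow> bool" where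
  "maximizing M A \<mu> \<longleftrightarrow> \<mu> \<in> inv_probs M \<and> integ \<mu> A = beta M A"

definition bounded_above_on :: "(nat \<Rightarrow> nat) set \<Rightarrow> ((nat \<Rightarrow> nat) \<Rightarrow> real) \<Rightarrow> bool" where
  "bounded_above_on S A \<longleftrightarrow> (\<exists>C. \<forall>x \<in> S. A x \<le> C)"

definition coercive :: "(nat \<Rightarrow> nat \<Rightarrow> bool) \<Rightarrow> ((nat \<Rightarrow> nat) \<Rightarrow> real) \<Rightarrow> bool" where
  "coercive M A \<longleftrightarrow> (\<forall>C::real. \<exists>N. \<forall>i \<ge> N. \<forall>x \<in> SigmaM M. x 0 = i \<longrightarrow> A x \<le> C)"

text \<open>Locally Hoelder: Var_k(A) \<le> H lam^k for all k \<ge> 1, where d(x,y) \<le> lam^k iff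
  x and y agree on the coordinates 0..k-1.\<close>
definition loc_holder :: "(nat \<Rightarrow> nat \<Rightarrow> bool) \<Rightarrow> real \<Rightarrow> ((nat \<Rightarrow> nat) \<Rightarrow> real) \<Rightarrow> bool" where
  "loc_holder M lam A \<longleftrightarrow> (\<exists>H > 0. \<forall>k \<ge> 1. \<forall>x \<in> SigmaM M. \<forall>y \<in> SigmaM M.
      (\<forall>j < k. x j = y j) \<longrightarrow> A x - A y \<le> H * lam ^ k)"

end

(* The potential is normalised by a sub-action: with b = beta and
     u x = sup {S_n (A - b) y | sigma^n y = x},
   finite because an orbit segment closes up to a periodic orbit at bounded cost, u is bounded and
   locally Hoelder, and B = A - b + u - u o sigma is <= 0. Integrating, an invariant probability is
   maximizing iff B vanishes almost everywhere, i.e. on its support; so the points whose whole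
   forward orbit lies in {B = 0} form the set Omega. On Omega the potential is >= b - sup u, and
   coercivity bounds all symbols there. For existence, almost optimal orbit segments satisfy
   S_n B >= -c, which again bounds their symbols, and a Krylov-Bogolyubov limit of their empirical
   measures gives no mass to {B < 0}. *)
theory Submission
  imports Defs
begin

section \<open>Orbits, Birkhoff sums and topology of the subshift\<close>

text \<open>\<open>SigmaM M\<close> need not be compact and \<open>A\<close> may be unbounded below,
  so neither weak compactness of the invariant probabilities nor continuity of the integral of
  \<open>A\<close> can be relied on. The sign of \<open>B\<close> replaces both: a lower bound on a
  Birkhoff sum of \<open>B\<close> bounds every single term, and it limits the number of visits to a
  cylinder on which \<open>B\<close> stays below a negative constant. No integral of
  \<open>A\<close> has to pass to the limit. This needs \<open>u\<close> to be bounded, so that its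
  coboundary integrates to 0 against every invariant probability and coercivity passes from
  \<open>A\<close> to \<open>B\<close>. The bound on \<open>u\<close> is where finite primitivity
  enters: connecting words have the fixed length \<open>K0\<close> and symbols in the finite set
  \<open>F\<close>, where \<open>A\<close> is bounded below, and shadowing a segment costs at most a
  geometric series.\<close>

lemma funpow_shift: "(shift ^^ n) x = (\<lambda>i. x (i + n))"
  by (induction n) (auto simp: shift_def)

lemma shift_SigmaM: "x \<in> SigmaM M \<Longrightarrow> shift x \<in> SigmaM M"
  by (auto simp: SigmaM_def shift_def)

lemma funpow_shift_SigmaM: "x \<in> SigmaM M \<Longrightarrow> (shift ^^ n) x \<in> SigmaM M"
  by (auto simp: SigmaM_def funpow_shift)

text \<open>Each symbol of a point is followed by another symbol of the same point, so it survives
  every stage of \<open>Bset\<close>. This makes \<open>primitive_wrt\<close> applicable to symbols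
  of points.\<close>

lemma SigmaM_in_core:
  assumes "x \<in> SigmaM M"
  shows "x j \<in> core M"
proof -
  have "x j \<in> Bset M n" for n
    using assms by (induction n arbitrary: j) (auto simp: SigmaM_def)
  then show ?thesis by (simp add: core_def)
qed

lemma SigmaM_connect:
  assumes prim: "primitive_wrt M F K0" and x: "x \<in> SigmaM M" and y: "y \<in> SigmaM M" and "n \<ge> 1"
  obtains z where "z \<in> SigmaM M" "\<And>i. i < n \<Longrightarrow> z i = x i" "\<And>i. z (i + (n + K0)) = y i"
    "\<And>i. n \<le> i \<Longrightarrow> i < n + K0 \<Longrightarrow> z i \<in> F"
proof -
  obtain l where l: "l 0 = x (n - 1)" "l (Suc K0) = y 0" "\<And>k. k \<in> {1..K0} \<Longrightarrow> l k \<in> F"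
    "\<And>k. k \<le> K0 \<Longrightarrow> M (l k) (l (Suc k))"
    using prim SigmaM_in_core[OF x] SigmaM_in_core[OF y] unfolding primitive_wrt_def by meson
  \<comment> \<open>The word \<open>l\<close> includes both endpoints: \<open>l 0\<close> sits at
    position \<open>n - 1\<close> and \<open>l (Suc K0)\<close> at position \<open>n + K0\<close>,
    whence the index \<open>Suc i - n\<close>.\<close>
  define z where "z i = (if i < n then x i else if i < n + K0 then l (Suc i - n) else y (i - (n + K0)))" for i
  \<comment> \<open>Agreement also at the two overlap positions turns every transition touching the
    inserted word into one of \<open>l\<close>.\<close>
  have zl: "z i = l (Suc i - n)" if i: "n \<le> Suc i" "i \<le> n + K0" for i
  proof -
    consider "Suc i = n" | "n \<le> i" "i < n + K0" | "i = n + K0" using i by linarith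
    then show ?thesis
    proof cases
      case 3
      then show ?thesis using l(2) by (simp add: z_def Suc_diff_le)
    qed (use l \<open>n \<ge> 1\<close> in \<open>auto simp: z_def\<close>)
  qed
  have "M (z i) (z (Suc i))" for i
  proof -
    consider "Suc i < n" | "n \<le> Suc i" "i < n + K0" | "n + K0 \<le> i" by linarith
    then show ?thesis
    proof cases
      case 1 then show ?thesis using x by (simp add: z_def SigmaM_def)
    next
      case 2
      then have "z i = l (Suc i - n)" "z (Suc i) = l (Suc (Suc i - n))" by (simp_all add: zl Suc_diff_le)
      with 2 show ?thesis using l(4)[of "Suc i - n"] by simp
    next
      case 3
      then show ?thesis using y by (simp add: z_def SigmaM_def Suc_diff_le)
    qed
  qed
  then have "z \<in> SigmaM M" by (simp add: SigmaM_def)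
  moreover have "z i \<in> F" if "n \<le> i" "i < n + K0" for i
  proof -
    have "Suc i - n \<in> {1..K0}" unfolding atLeastAtMost_iff using that by linarith
    with that l(3) show ?thesis by (auto simp: z_def)
  qed
  ultimately show ?thesis by (intro that[of z]) (auto simp: z_def)
qed

text \<open>Connecting \<open>x\<close> to itself gives a point \<open>y\<close> with
  \<open>y p = y 0\<close> for \<open>p = n + K0\<close>; hence repeating its first \<open>p\<close>
  symbols creates no forbidden transition at the seam.\<close>

lemma SigmaM_periodic_closure:
  assumes prim: "primitive_wrt M F K0" and x: "x \<in> SigmaM M" and "n \<ge> 1"
  obtains z where "z \<in> SigmaM M" "\<And>i. i < n \<Longrightarrow> z i = x i" "(shift ^^ (n + K0)) z = z"
    "\<And>i. n \<le> i \<Longrightarrow> i < n + K0 \<Longrightarrow> z i \<in> F"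
proof -
  obtain y where y: "y \<in> SigmaM M" "\<And>i. i < n \<Longrightarrow> y i = x i" "\<And>i. y (i + (n + K0)) = x i"
    "\<And>i. n \<le> i \<Longrightarrow> i < n + K0 \<Longrightarrow> y i \<in> F"
    using SigmaM_connect[OF prim x x \<open>n \<ge> 1\<close>] by metis
  define p where "p = n + K0"
  have p: "p > 0" using \<open>n \<ge> 1\<close> by (simp add: p_def)
  define z where "z i = y (i mod p)" for i
  have "y p = y 0" using y(2)[of 0] y(3)[of 0] \<open>n \<ge> 1\<close> by (simp add: p_def)
  then have "z (Suc i) = y (Suc (i mod p))" for i
    using p by (auto simp: z_def mod_Suc)
  then have "z \<in> SigmaM M" using y(1) by (auto simp: SigmaM_def z_def)
  moreover have "(shift ^^ p) z = z" by (auto simp: funpow_shift z_def)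
  ultimately show ?thesis using y(2,4)
    by (intro that[of z]) (auto simp: z_def p_def)
qed

section \<open>Birkhoff sums\<close>

definition birkhoff_sum :: "((nat \<Rightarrow> nat) \<Rightarrow> real) \<Rightarrow> nat \<Rightarrow> (nat \<Rightarrow> nat) \<Rightarrow> real" where
  "birkhoff_sum f n x = (\<Sum>j<n. f ((shift ^^ j) x))"

lemma birkhoff_sum_add:
  "birkhoff_sum f (m + n) x = birkhoff_sum f m x + birkhoff_sum f n ((shift ^^ m) x)"
proof -
  have "birkhoff_sum f (m + n) x = sum (\<lambda>j. f ((shift ^^ j) x)) {..<m} + (\<Sum>j\<in>{m..<m+n}. f ((shift ^^ j) x))"
    unfolding birkhoff_sum_def
    by (subst sum.union_disjoint[symmetric]) (auto intro!: sum.cong)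
  also have "(\<Sum>j\<in>{m..<m+n}. f ((shift ^^ j) x)) = (\<Sum>j<n. f ((shift ^^ j) ((shift ^^ m) x)))"
    by (rule sum.reindex_bij_witness[of _ "\<lambda>j. j + m" "\<lambda>j. j - m"])
      (auto simp: funpow_shift add.assoc)
  finally show ?thesis by (simp add: birkhoff_sum_def)
qed

lemma birkhoff_sum_diff_const: "birkhoff_sum (\<lambda>x. f x - c) n x = birkhoff_sum f n x - n * c"
  by (simp add: birkhoff_sum_def sum_subtractf)

lemma birkhoff_sum_coboundary: "birkhoff_sum (\<lambda>x. u x - u (shift x)) n x = u x - u ((shift ^^ n) x)"
  unfolding birkhoff_sum_def
  using sum_lessThan_telescope'[of "\<lambda>j. u ((shift ^^ j) x)" n] by simp

section \<open>Cylinders and the topology of the subshift\<close>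

lemma open_coordinate: "open {y :: nat \<Rightarrow> nat. P (y j)}"
proof -
  have "open ((\<lambda>y :: nat \<Rightarrow> nat. y j) -` {a. P a})"
    by (intro open_vimage Topological_Spaces.open_discrete continuous_on_product_coordinates)
  then show ?thesis by (simp add: vimage_def)
qed

lemma closed_coordinate: "closed {y :: nat \<Rightarrow> nat. P (y j)}"
  using open_coordinate[of "\<lambda>a. \<not> P a" j] by (simp add: closed_def Compl_eq)

lemma open_cylinder: "open {y :: nat \<Rightarrow> nat. \<forall>j<k. y j = x j}"
proof -
  have "{y :: nat \<Rightarrow> nat. \<forall>j<k. y j = x j} = (\<Inter>j<k. {y. y j = x j})" by auto
  moreover have "open {y::nat \<Rightarrow> nat. y j = x j}" for j by (rule open_coordinate)
  ultimately show ?thesis by (auto intro!: open_INT)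
qed

lemma continuous_on_shift: "continuous_on S shift"
  unfolding shift_def
  by (intro continuous_on_coordinatewise_then_product)
    (rule continuous_on_subset[OF continuous_on_product_coordinates], simp)

lemma continuous_on_funpow_shift: "continuous_on S (shift ^^ n)"
  by (simp add: funpow_shift[abs_def])
    (intro continuous_on_coordinatewise_then_product,
      rule continuous_on_subset[OF continuous_on_product_coordinates], simp)

lemma closed_SigmaM: "closed (SigmaM M)"
proof -
  have "SigmaM M = (\<Inter>j. {x. M (x j) (x (Suc j))})" by (auto simp: SigmaM_def)
  moreover have "closed {x :: nat \<Rightarrow> nat. M (x j) (x (Suc j))}" for j
  proof -
    have "{x :: nat \<Rightarrow> nat. M (x j) (x (Suc j))} =
        - (\<Union>a. \<Union>b\<in>{b. \<not> M a b}. {x. x j = a} \<inter> {x. x (Suc j) = b})"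
      by auto
    moreover have "open (\<Union>a. \<Union>b\<in>{b. \<not> M a b}. {x :: nat \<Rightarrow> nat. x j = a} \<inter> {x. x (Suc j) = b})"
      by (intro open_UN ballI open_Int open_coordinate)
    ultimately show ?thesis by (simp only: closed_Compl)
  qed
  ultimately show ?thesis by (auto intro!: closed_INT)
qed

text \<open>Tychonoff's theorem, used twice: for sequences over a bounded alphabet and for set
  functions with values in [0,1].\<close>

lemma compact_PiE_UNIV:
  fixes S :: "'i \<Rightarrow> 'a::topological_space set"
  assumes "\<And>i. compact (S i)"
  shows "compact (PiE UNIV S)"
  using assms compactin_PiE[of "\<lambda>i. euclidean" UNIV S]
  by (simp add: euclidean_product_topology)

lemma compact_SigmaI: "compact (SigmaI M N)"
proof -
  have "SigmaI M N = SigmaM M \<inter> PiE UNIV (\<lambda>_. {..N})" by (auto simp: SigmaI_def PiE_UNIV_domain)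
  then show ?thesis
    by (simp add: closed_Int_compact closed_SigmaM compact_PiE_UNIV finite_imp_compact)
qed

lemma shift_SigmaI: "x \<in> SigmaI M N \<Longrightarrow> shift x \<in> SigmaI M N"
  by (auto simp: SigmaI_def shift_SigmaM) (simp add: shift_def)

text \<open>A cylinder of length \<open>k\<close> is a neighbourhood on which \<open>g\<close>
  oscillates by at most \<open>G * lam ^ k\<close>; the one-sided bound suffices because
  \<open>x\<close> and \<open>y\<close> can be exchanged. Serves both the potential and the
  sub-action.\<close>

lemma continuous_on_SigmaM_if_holder:
  fixes g :: "(nat \<Rightarrow> nat) \<Rightarrow> real"
  assumes lam: "0 < lam" "lam < 1"
    and holder: "\<And>k x y. \<lbrakk>1 \<le> k; x \<in> S; y \<in> S; \<forall>j<k. x j = y j\<rbrakk> \<Longrightarrow> g x - g y \<le> G * lam ^ k"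
  shows "continuous_on S g"
proof (unfold continuous_on_def, intro ballI tendstoI)
  fix x and e :: real assume x: "x \<in> S" and e: "e > 0"
  have "(\<lambda>k. G * lam ^ k) \<longlonglongrightarrow> G * 0"
    using lam by (intro tendsto_intros LIMSEQ_power_zero) auto
  then have "\<forall>\<^sub>F k in sequentially. G * lam ^ k < e"
    using e by (intro order_tendstoD) auto
  moreover have "\<forall>\<^sub>F k :: nat in sequentially. k \<ge> 1" by (rule eventually_ge_at_top)
  ultimately have "\<forall>\<^sub>F k in sequentially. G * lam ^ k < e \<and> k \<ge> 1" by eventually_elim auto
  then obtain k where k: "G * lam ^ k < e" "k \<ge> 1"
    by (auto simp: eventually_sequentially)
  have "dist (g y) (g x) < e" if "y \<in> S" "\<forall>j<k. y j = x j" for y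
    using holder[of k y x] holder[of k x y] k that x by (auto simp: dist_real_def)
  then show "\<forall>\<^sub>F y in at x within S. dist (g y) (g x) < e"
    using open_cylinder[of k x] unfolding eventually_at_topological by fastforce
qed

section \<open>Invariant probabilities\<close>

lemma inv_probsD:
  assumes "\<mu> \<in> inv_probs M"
  shows sets_inv_probs: "sets \<mu> = sets (restrict_space borel (SigmaM M))"
    and space_inv_probs: "space \<mu> = SigmaM M"
    and prob_space_inv_probs: "prob_space \<mu>"
  using assms sets_eq_imp_space_eq[of \<mu> "restrict_space borel (SigmaM M)"]
  by (auto simp: inv_probs_def space_restrict_space)

lemma measurable_shift:
  assumes "sets \<mu> = sets (restrict_space borel (SigmaM M))"
  shows "shift \<in> measurable \<mu> \<mu>"
proof -
  have "shift \<in> borel_measurable (restrict_space borel (SigmaM M))"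
    by (intro borel_measurable_continuous_on_restrict continuous_on_shift)
  then have "shift \<in> measurable (restrict_space borel (SigmaM M)) (restrict_space borel (SigmaM M))"
    by (intro measurable_restrict_space2) (auto simp: space_restrict_space shift_SigmaM)
  then show ?thesis using measurable_cong_sets[OF assms assms] by simp
qed

lemma distr_shift:
  assumes "\<mu> \<in> inv_probs M"
  shows "distr \<mu> \<mu> shift = \<mu>"
proof (rule measure_eqI)
  fix B assume "B \<in> sets (distr \<mu> \<mu> shift)"
  then show "emeasure (distr \<mu> \<mu> shift) B = emeasure \<mu> B"
    using assms measurable_shift[OF sets_inv_probs[OF assms]] space_inv_probs[OF assms]
    by (simp add: emeasure_distr inv_probs_def)
qed simp

lemma inv_probsI:
  assumes sets: "sets \<mu> = sets (restrict_space borel (SigmaM M))" and "prob_space \<mu>"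
    and "distr \<mu> \<mu> shift = \<mu>"
  shows "\<mu> \<in> inv_probs M"
proof -
  have "emeasure \<mu> (shift -` B \<inter> space \<mu>) = emeasure \<mu> B" if "B \<in> sets \<mu>" for B
    using emeasure_distr[OF measurable_shift[OF sets] that] assms(3) by simp
  then show ?thesis
    using assms sets_eq_imp_space_eq[OF sets]
    by (auto simp: inv_probs_def space_restrict_space)
qed

lemma borel_measurable_inv_probs:
  fixes g :: "(nat \<Rightarrow> nat) \<Rightarrow> real"
  assumes "\<mu> \<in> inv_probs M" and "continuous_on (SigmaM M) g"
  shows "g \<in> borel_measurable \<mu>"
  using borel_measurable_continuous_on_restrict[OF assms(2)]
    measurable_cong_sets[OF sets_inv_probs[OF assms(1)] refl] by blast

lemma integral_shift_inv_probs:
  fixes g :: "(nat \<Rightarrow> nat) \<Rightarrow> real"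
  assumes "\<mu> \<in> inv_probs M" and "continuous_on (SigmaM M) g"
  shows "(\<integral>x. g (shift x) \<partial>\<mu>) = (\<integral>x. g x \<partial>\<mu>)"
    and "integrable \<mu> (\<lambda>x. g (shift x)) \<longleftrightarrow> integrable \<mu> g"
proof -
  note s = measurable_shift[OF sets_inv_probs[OF assms(1)]]
    and g = borel_measurable_inv_probs[OF assms]
  show "(\<integral>x. g (shift x) \<partial>\<mu>) = (\<integral>x. g x \<partial>\<mu>)"
    using integral_distr[OF s g] distr_shift[OF assms(1)] by simp
  show "integrable \<mu> (\<lambda>x. g (shift x)) \<longleftrightarrow> integrable \<mu> g"
    using integrable_distr_eq[OF s g] distr_shift[OF assms(1)] by simp
qed

text \<open>By invariance the preimage of a null set under the shift is null. This leads from
  vanishing almost everywhere to vanishing along whole orbits.\<close>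

lemma AE_funpow_shift:
  fixes g :: "(nat \<Rightarrow> nat) \<Rightarrow> real"
  assumes "\<mu> \<in> inv_probs M" and "continuous_on (SigmaM M) g" and "AE x in \<mu>. g x = 0"
  shows "AE x in \<mu>. g ((shift ^^ n) x) = 0"
proof (induction n)
  case (Suc n)
  note s = measurable_shift[OF sets_inv_probs[OF assms(1)]]
  have "continuous_on (SigmaM M) (\<lambda>x. g ((shift ^^ n) x))"
    by (rule continuous_on_compose2[OF assms(2) continuous_on_funpow_shift])
      (auto simp: funpow_shift_SigmaM)
  then have "(\<lambda>x. g ((shift ^^ n) x)) \<in> borel_measurable \<mu>"
    by (rule borel_measurable_inv_probs[OF assms(1)])
  then have "{x \<in> space \<mu>. g ((shift ^^ n) x) = 0} \<in> sets \<mu>" by measurable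
  moreover have "AE x in distr \<mu> \<mu> shift. g ((shift ^^ n) x) = 0"
    unfolding distr_shift[OF assms(1)] by (rule Suc)
  ultimately have "AE x in \<mu>. g ((shift ^^ n) (shift x)) = 0"
    by (rule AE_distr_iff[OF s, THEN iffD1])
  then show ?case by (simp add: funpow_swap1)
qed (use assms in simp)

text \<open>By second countability the complement of the support is covered by countably many null
  basic open sets.\<close>

lemma AE_in_supp:
  assumes "\<mu> \<in> inv_probs M"
  shows "AE x in \<mu>. x \<in> supp \<mu>"
proof -
  obtain B :: "(nat \<Rightarrow> nat) set set" where B: "countable B" "topological_basis B"
    using ex_countable_basis by auto
  define N where "N = {U \<in> B. emeasure \<mu> (U \<inter> space \<mu>) = 0}"
  have U_sets: "U \<inter> space \<mu> \<in> sets \<mu>" if "U \<in> B" for U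
    using topological_basis_open[OF B(2) that] inv_probsD[OF assms]
    by (auto simp: sets_restrict_space)
  have null: "U \<inter> space \<mu> \<in> null_sets \<mu>" if "U \<in> N" for U
    using U_sets that by (auto simp: N_def)
  have "countable N" using B(1) by (simp add: N_def)
  then have "AE x in \<mu>. \<forall>U\<in>N. x \<notin> U \<inter> space \<mu>"
    using AE_not_in[OF null] by (simp add: AE_ball_countable)
  moreover have "x \<in> supp \<mu>" if x: "x \<in> space \<mu>" "\<forall>U\<in>N. x \<notin> U \<inter> space \<mu>" for x
  proof -
    have "emeasure \<mu> (U \<inter> space \<mu>) > 0" if U: "open U" "x \<in> U" for U
    proof -
      obtain V where V: "V \<in> B" "x \<in> V" "V \<subseteq> U"
        using topological_basisE[OF B(2) U] by metis
      with x have "emeasure \<mu> (V \<inter> space \<mu>) \<noteq> 0" by (auto simp: N_def)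
      moreover have "emeasure \<mu> (V \<inter> space \<mu>) \<le> emeasure \<mu> (U \<inter> space \<mu>)"
        using V U inv_probsD[OF assms] by (intro emeasure_mono) (auto simp: sets_restrict_space)
      ultimately show ?thesis by (metis not_gr_zero le_zero_eq)
    qed
    with x show ?thesis by (simp add: supp_def)
  qed
  ultimately show ?thesis by (rule AE_mp[OF _ AE_I2, rule_format]) auto
qed

text \<open>The set where \<open>g\<close> is nonzero is relatively open; if it is null, it contains
  no point of the support. Conversely the support carries full measure.\<close>

lemma AE_zero_iff_supp:
  fixes g :: "(nat \<Rightarrow> nat) \<Rightarrow> real"
  assumes \<mu>: "\<mu> \<in> inv_probs M" and g: "continuous_on (SigmaM M) g"
  shows "(AE x in \<mu>. g x = 0) \<longleftrightarrow> (\<forall>x\<in>supp \<mu>. g x = 0)"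
proof
  assume AE: "AE x in \<mu>. g x = 0"
  show "\<forall>x\<in>supp \<mu>. g x = 0"
  proof (rule ballI, rule ccontr)
    fix x assume x: "x \<in> supp \<mu>" "g x \<noteq> 0"
    obtain U where U: "open U" "U \<inter> SigmaM M = g -` (- {0}) \<inter> SigmaM M"
      using g[unfolded continuous_on_open_invariant, rule_format, of "- {0}"] by auto
    have "AE y in \<mu>. y \<notin> U \<inter> SigmaM M"
      using AE U(2) by auto
    then have "emeasure \<mu> (U \<inter> SigmaM M) = 0"
      using U(1) inv_probsD[OF \<mu>] by (subst (asm) AE_iff_null_sets[symmetric])
        (auto simp: sets_restrict_space null_sets_def)
    moreover have "x \<in> U" using x U(2) space_inv_probs[OF \<mu>] by (auto simp: supp_def)
    ultimately show False
      using x U(1) space_inv_probs[OF \<mu>] by (auto simp: supp_def)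
  qed
next
  assume "\<forall>x\<in>supp \<mu>. g x = 0"
  with AE_in_supp[OF \<mu>] show "AE x in \<mu>. g x = 0" by auto
qed

text \<open>The measure is the image of the uniform distribution on \<open>{..<p}\<close> under the
  orbit map; \<open>p\<close> is any period, so an orbit point may be counted several times.\<close>

lemma periodic_orbit_measure:
  assumes z: "z \<in> SigmaM M" and p: "(shift ^^ p) z = z" "p > 0"
  obtains \<mu> where "\<mu> \<in> inv_probs M"
    "\<And>f :: _ \<Rightarrow> real. f \<in> borel_measurable \<mu> \<Longrightarrow> integrable \<mu> f \<and> (\<integral>x. f x \<partial>\<mu>) = birkhoff_sum f p z / p"
proof -
  define P where "P = measure_pmf (pmf_of_set {..<p})"
  define orb where "orb j = (shift ^^ j) z" for j
  define \<mu> where "\<mu> = distr P (restrict_space borel (SigmaM M)) orb"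
  have fin: "finite (set_pmf (pmf_of_set {..<p}))" using p by (subst set_pmf_of_set) auto
  have sets: "sets \<mu> = sets (restrict_space borel (SigmaM M))" by (simp add: \<mu>_def)
  have orb: "orb \<in> measurable P (restrict_space borel (SigmaM M))"
    by (rule measurableI) (auto simp: P_def orb_def space_restrict_space funpow_shift_SigmaM z)
  have "prob_space P" unfolding P_def by (rule measure_pmf.prob_space_axioms)
  then have prob: "prob_space \<mu>" unfolding \<mu>_def by (intro prob_space.prob_space_distr orb)
  interpret prob_space \<mu> by (rule prob)
  have int: "integrable \<mu> f \<and> (\<integral>x. f x \<partial>\<mu>) = birkhoff_sum f p z / p"
    if f: "f \<in> borel_measurable \<mu>" for f :: "_ \<Rightarrow> real"
  proof -
    have f': "f \<in> borel_measurable (restrict_space borel (SigmaM M))"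
      using f measurable_cong_sets[OF sets refl] by blast
    have "integrable P (\<lambda>j. f (orb j))"
      unfolding P_def by (rule integrable_measure_pmf_finite[OF fin])
    moreover have "(\<integral>j. f (orb j) \<partial>P) = birkhoff_sum f p z / p"
      unfolding P_def using p by (subst integral_pmf_of_set) (auto simp: birkhoff_sum_def orb_def)
    ultimately show ?thesis
      using integrable_distr_eq[OF orb f'] integral_distr[OF orb f'] by (simp add: \<mu>_def)
  qed
  have "distr \<mu> \<mu> shift = \<mu>"
  proof (rule measure_eqI)
    fix B assume "B \<in> sets (distr \<mu> \<mu> shift)"
    then have B: "B \<in> sets \<mu>" by simp
    note s = measurable_shift[OF sets]
    have "measure \<mu> (shift -` B \<inter> space \<mu>) = (\<integral>x. indicator (shift -` B \<inter> space \<mu>) x \<partial>\<mu>)"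
      by simp
    also have "\<dots> = (\<integral>x. indicator B (shift x) \<partial>\<mu>)"
      by (intro Bochner_Integration.integral_cong) (auto simp: indicator_def)
    also have "\<dots> = birkhoff_sum (\<lambda>x. indicator B (shift x)) p z / p"
      using int[of "\<lambda>x. indicator B (shift x)"] s B by simp
    \<comment> \<open>Telescoping: the two sums differ by the values at \<open>z\<close> and
      \<open>(shift ^^ p) z\<close>, which are the same point.\<close>
    also have "birkhoff_sum (\<lambda>x. indicator B (shift x)) p z = birkhoff_sum (indicator B) p z"
      using birkhoff_sum_coboundary[of "indicator B" p z] p
      by (simp add: birkhoff_sum_def sum_subtractf)
    also have "\<dots> / p = measure \<mu> B"
      using int[of "indicator B"] B sets.Int_space_eq2[OF B] by simp
    finally show "emeasure (distr \<mu> \<mu> shift) B = emeasure \<mu> B"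
      using B s by (simp add: emeasure_distr emeasure_eq_measure)
  qed simp
  from inv_probsI[OF sets prob this] int show ?thesis by (rule that)
qed

section \<open>Clopen sets and limits of empirical measures\<close>

lemma compact_cluster_filter:
  fixes e :: "nat \<Rightarrow> 'a::topological_space"
  assumes "compact K" and "\<And>n. e n \<in> K"
  obtains f G where "f \<in> K" "G \<noteq> bot" "G \<le> sequentially" "(e \<longlongrightarrow> f) G"
proof -
  have "filtermap e sequentially \<noteq> bot" by (simp add: filtermap_bot_iff)
  moreover have "\<forall>\<^sub>F x in filtermap e sequentially. x \<in> K"
    using assms(2) by (simp add: eventually_filtermap)
  ultimately obtain f where f: "f \<in> K" "inf (nhds f) (filtermap e sequentially) \<noteq> bot"
    using assms(1)[unfolded compact_filter] by blast
  \<comment> \<open>In the application the compact space is a product over uncountably many sets,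
    where a convergent subsequence need not exist. This filter, finer than
    \<open>sequentially\<close>, takes its place.\<close>
  define G where "G = inf (filtercomap e (nhds f)) sequentially"
  have "G \<noteq> bot"
  proof
    assume "G = bot"
    then have "eventually (\<lambda>_. False) G" by simp
    then obtain Q R where Q: "eventually Q (filtercomap e (nhds f))" and R: "eventually R sequentially"
      and QR: "\<And>n. Q n \<Longrightarrow> R n \<Longrightarrow> False"
      unfolding G_def eventually_inf by blast
    from Q obtain Q' where Q': "eventually Q' (nhds f)" "\<And>n. Q' (e n) \<Longrightarrow> Q n"
      unfolding eventually_filtercomap by blast
    have "eventually (\<lambda>x. \<not> Q' x) (filtermap e sequentially)"
      unfolding eventually_filtermap using R by eventually_elim (use Q'(2) QR in blast)
    with Q'(1) have "eventually (\<lambda>_. False) (inf (nhds f) (filtermap e sequentially))"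
      unfolding eventually_inf by blast
    with f(2) show False by (simp add: trivial_limit_def)
  qed
  moreover have "(e \<longlongrightarrow> f) G"
    unfolding G_def filterlim_iff_le_filtercomap by simp
  ultimately show ?thesis using f(1) by (intro that[of f G]) (auto simp: G_def)
qed

text \<open>For closed \<open>S\<close> these are the relatively clopen subsets of \<open>S\<close>.
  They form an algebra that generates the Borel sets, and the limit measure is first defined
  there.\<close>

definition clopens :: "(nat \<Rightarrow> nat) set \<Rightarrow> (nat \<Rightarrow> nat) set set" where
  "clopens S = {X. X \<subseteq> S \<and> closed X \<and> closed (S - X)}"

lemma clopens_coordinate:
  assumes "closed S"
  shows "{x \<in> S. P (x j)} \<in> clopens S"
proof -
  have "{x \<in> S. P (x j)} = S \<inter> {x. P (x j)}" "S - {x \<in> S. P (x j)} = S \<inter> {x. \<not> P (x j)}"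
    by auto
  then show ?thesis
    using assms closed_coordinate by (auto simp: clopens_def intro!: closed_Int)
qed

lemma clopens_cylinder:
  assumes "closed S"
  shows "{y \<in> S. \<forall>j<k. y j = x j} \<in> clopens S"
proof -
  have "{y \<in> S. \<forall>j<k. y j = x j} = S \<inter> (\<Inter>j<k. {y. y j = x j})" by auto
  moreover have "S - {y \<in> S. \<forall>j<k. y j = x j} = S \<inter> (\<Union>j<k. {y. y j \<noteq> x j})" by auto
  moreover have "closed (\<Inter>j<k. {y::nat \<Rightarrow> nat. y j = x j})" "closed (\<Union>j<k. {y::nat \<Rightarrow> nat. y j \<noteq> x j})"
    using closed_coordinate[of "\<lambda>a. a = x _"] closed_coordinate[of "\<lambda>a. a \<noteq> x _"]
    by (auto intro!: closed_INT closed_UN)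
  ultimately show ?thesis
    using assms by (simp add: clopens_def closed_Int)
qed

lemma clopens_algebra:
  assumes "closed S"
  shows "algebra S (clopens S)"
proof (unfold algebra_iff_Un, intro conjI ballI)
  fix a b assume a: "a \<in> clopens S"
  then have "S - (S - a) = a" by (auto simp: clopens_def)
  then show "S - a \<in> clopens S" using a by (auto simp: clopens_def)
  assume b: "b \<in> clopens S"
  have "S - (a \<union> b) = (S - a) \<inter> (S - b)" by auto
  then show "a \<union> b \<in> clopens S" using a b by (auto simp: clopens_def)
qed (use assms in \<open>auto simp: clopens_def\<close>)

text \<open>Coordinate sets are clopen, and measurability into a countable product is decided by the
  coordinates; so the identity is Borel measurable for the generated sigma-algebra.\<close>

lemma sigma_sets_clopens:
  assumes "closed S"
  shows "sigma_sets S (clopens S) = sets (restrict_space borel S)"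
proof
  have "clopens S \<subseteq> sets (restrict_space borel S)"
    by (auto simp: clopens_def sets_restrict_space image_iff intro!: bexI[rotated])
  then show "sigma_sets S (clopens S) \<subseteq> sets (restrict_space borel S)"
    using sets.sigma_sets_subset[of "clopens S" "restrict_space borel S"]
    by (simp add: space_restrict_space)
  define R where "R = sigma S (clopens S)"
  have pow: "clopens S \<subseteq> Pow S" by (auto simp: clopens_def)
  then have R: "space R = S" "sets R = sigma_sets S (clopens S)" by (simp_all add: R_def)
  have "(\<lambda>x. x) \<in> borel_measurable R"
  proof (intro measurable_coordinatewise_then_product measurableI)
    fix i and B :: "nat set"
    have "{x \<in> S. x i \<in> B} \<in> sigma_sets S (clopens S)"
      using clopens_coordinate[OF assms, of "\<lambda>a. a \<in> B"] by blast
    then show "(\<lambda>x. x i) -` B \<inter> space R \<in> sets R" by (simp add: R vimage_def Int_def conj_commute)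
  qed auto
  from measurable_sets[OF this] show "sets (restrict_space borel S) \<subseteq> sigma_sets S (clopens S)"
    by (auto simp: sets_restrict_space R Int_commute)
qed

lemma birkhoff_sum_indicator_bounds:
  "0 \<le> birkhoff_sum (indicator X) n x" "birkhoff_sum (indicator X) n x \<le> n"
  using sum_bounded_above[of "{..<n}" "\<lambda>j. indicator X ((shift ^^ j) x) :: real" 1]
  by (auto simp: birkhoff_sum_def intro!: sum_nonneg simp: indicator_def)

text \<open>Countable additivity of a limit of empirical measures comes for free on clopen sets: if
  clopen sets decrease to the empty set, one of them misses the compact set carrying all orbits.\<close>

lemma krylov_bogolyubov:
  assumes y: "\<And>n. y n \<in> SigmaI M N"
  shows "\<exists>\<mu>\<in>inv_probs M. \<forall>X\<in>clopens (SigmaM M).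
    (\<lambda>n. birkhoff_sum (indicator X) n (y n) / n) \<longlonglongrightarrow> 0 \<longrightarrow> emeasure \<mu> X = 0"
proof -
  define S where "S = SigmaM M"
  \<comment> \<open>For \<open>n = 0\<close> the division by zero gives \<open>e 0 X = 0\<close>, so
    total mass 1 holds only from \<open>n = 1\<close> on; the limit does not see this.\<close>
  define e where "e n X = birkhoff_sum (indicator X) n (y n) / n" for n and X :: "(nat \<Rightarrow> nat) set"
  have S: "closed S" by (simp add: S_def closed_SigmaM)
  have orbit: "(shift ^^ j) (y n) \<in> SigmaI M N" for j n
    by (induction j) (simp_all add: y shift_SigmaI)
  then have orbit_S: "(shift ^^ j) (y n) \<in> S" for j n by (auto simp: SigmaI_def S_def)
  have "e n X \<in> {0..1}" for n X
    using birkhoff_sum_indicator_bounds[of X n "y n"]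
    by (cases "n = 0") (auto simp: e_def divide_le_eq)
  then have "e n \<in> PiE UNIV (\<lambda>_. {0..1})" for n by (simp add: PiE_UNIV_domain)
  \<comment> \<open>The limit is taken at all sets simultaneously; finite additivity is an equation
    that survives it.\<close>
  moreover have "compact (PiE UNIV (\<lambda>_ :: (nat \<Rightarrow> nat) set. {0..1::real}))"
    by (intro compact_PiE_UNIV compact_Icc)
  ultimately obtain f G where f: "f \<in> PiE UNIV (\<lambda>_. {0..1})" and G: "G \<noteq> bot" "G \<le> sequentially"
    and lim: "(e \<longlongrightarrow> f) G"
    using compact_cluster_filter by metis
  have lim: "((\<lambda>n. e n X) \<longlongrightarrow> f X) G" for X
    using continuous_on_tendsto_compose[OF continuous_on_product_coordinates[of X] lim] by simp
  have f_eq: "f X = c" if "(\<lambda>n. e n X) \<longlonglongrightarrow> c" for X c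
    using tendsto_unique[OF G(1) lim tendsto_mono[OF G(2) that]] .
  have f_nonneg: "f X \<ge> 0" for X using f by (auto simp: PiE_def Pi_def)
  have f_add: "f (X \<union> Y) = f X + f Y" if "X \<inter> Y = {}" for X Y
  proof -
    have "e n (X \<union> Y) = e n X + e n Y" for n
      using that by (simp add: e_def birkhoff_sum_def indicator_disj_union sum.distrib add_divide_distrib)
    with lim[of "X \<union> Y"] have "((\<lambda>n. e n X + e n Y) \<longlongrightarrow> f (X \<union> Y)) G" by simp
    from tendsto_unique[OF G(1) this tendsto_add[OF lim lim]] show ?thesis .
  qed
  have "e n S = 1" if "n \<ge> 1" for n
    using that orbit_S by (simp add: e_def birkhoff_sum_def)
  then have f_S: "f S = 1"
    by (intro f_eq tendsto_eventually) (auto simp: eventually_sequentially)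
  have f_empty: "f {} = 0" using f_add[of "{}" "{}"] by simp
  have f_shift: "f (shift -` X \<inter> S) = f X" for X
  proof -
    \<comment> \<open>Passing to the preimage replaces the visit at time 0 by the one at time
      \<open>n\<close>, an error of at most 1/n.\<close>
    have eq: "e n (shift -` X \<inter> S) = e n X - (indicator X (y n) - indicator X ((shift ^^ n) (y n))) / n" for n
    proof -
      have "birkhoff_sum (indicator (shift -` X \<inter> S)) n (y n) = birkhoff_sum (\<lambda>x. indicator X (shift x)) n (y n)"
        using orbit_S by (simp add: birkhoff_sum_def indicator_def)
      then show ?thesis
        using birkhoff_sum_coboundary[of "indicator X :: _ \<Rightarrow> real" n "y n"]
        by (simp add: e_def birkhoff_sum_def sum_subtractf diff_divide_distrib[symmetric])
    qed
    have "(\<lambda>n. (indicator X (y n) - indicator X ((shift ^^ n) (y n))) / real n) \<longlonglongrightarrow> 0"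
    proof (rule Lim_null_comparison)
      show "\<forall>\<^sub>F n in sequentially. norm ((indicator X (y n) - indicator X ((shift ^^ n) (y n))) / real n) \<le> 1 / real n"
        by (auto simp: indicator_def)
    qed (rule lim_1_over_n)
    from tendsto_diff[OF lim[of X] tendsto_mono[OF G(2) this]]
    have "((\<lambda>n. e n (shift -` X \<inter> S)) \<longlongrightarrow> f X) G" by (simp add: eq)
    from tendsto_unique[OF G(1) lim this] show ?thesis .
  qed
  interpret algebra S "clopens S" by (rule clopens_algebra[OF S])
  have "\<exists>\<nu>. (\<forall>X\<in>clopens S. \<nu> X = ennreal (f X)) \<and> measure_space S (sigma_sets S (clopens S)) \<nu>"
  proof (rule caratheodory_empty_continuous)
    show "positive (clopens S) (\<lambda>X. ennreal (f X))" by (simp add: positive_def f_empty)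
    show "additive (clopens S) (\<lambda>X. ennreal (f X))"
      by (simp add: additive_def f_add f_nonneg ennreal_plus)
  next
    fix A :: "nat \<Rightarrow> (nat \<Rightarrow> nat) set"
    assume A: "range A \<subseteq> clopens S" "decseq A" "(\<Inter>i. A i) = {}"
    have "\<exists>i. SigmaI M N \<inter> A i = {}"
    proof (rule ccontr)
      assume *: "\<nexists>i. SigmaI M N \<inter> A i = {}"
      have "SigmaI M N \<inter> (\<Inter>i\<in>UNIV. A i) \<noteq> {}"
      proof (rule compact_imp_fip_image[OF compact_SigmaI])
        fix i show "closed (A i)" using A(1) by (auto simp: clopens_def)
      next
        fix I :: "nat set" assume I: "finite I"
        have "A (Max (insert 0 I)) \<subseteq> A i" if "i \<in> I" for i
          using A(2) I that by (auto simp: decseq_def intro!: Max_ge)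
        with * show "SigmaI M N \<inter> (\<Inter>i\<in>I. A i) \<noteq> {}" by blast
      qed
      with A(3) show False by simp
    qed
    then obtain i where i: "SigmaI M N \<inter> A i = {}" ..
    \<comment> \<open>Once \<open>A j\<close> misses \<open>SigmaI M N\<close>, every empirical
      measure gives it mass 0, so the limit is exactly 0.\<close>
    have "f (A j) = 0" if "j \<ge> i" for j
    proof (rule f_eq)
      have "(shift ^^ k) (y n) \<notin> A j" for k n
        using i orbit[of k n] decseqD[OF A(2) that] by blast
      then show "(\<lambda>n. e n (A j)) \<longlonglongrightarrow> 0" by (simp add: e_def birkhoff_sum_def)
    qed
    then have "\<forall>\<^sub>F j in sequentially. ennreal (f (A j)) = 0"
      unfolding eventually_sequentially by (intro exI[of _ i]) simp
    then show "(\<lambda>j. ennreal (f (A j))) \<longlonglongrightarrow> 0" by (rule tendsto_eventually)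
  qed simp
  then obtain \<nu> where \<nu>: "\<And>X. X \<in> clopens S \<Longrightarrow> \<nu> X = ennreal (f X)"
    "measure_space S (sigma_sets S (clopens S)) \<nu>" by blast
  define \<mu> where "\<mu> = measure_of S (sigma_sets S (clopens S)) \<nu>"
  have pow: "clopens S \<subseteq> Pow S" by (auto simp: clopens_def)
  interpret sa: sigma_algebra S "sigma_sets S (clopens S)" by (rule sigma_algebra_sigma_sets[OF pow])
  have sp: "space \<mu> = S" and sets: "sets \<mu> = sigma_sets S (clopens S)"
    unfolding \<mu>_def by (rule sa.space_measure_of_eq, rule sa.sets_measure_of_eq)
  have em: "emeasure \<mu> X = ennreal (f X)" if "X \<in> clopens S" for X
    unfolding \<mu>_def using \<nu> that
    by (subst emeasure_measure_of_sigma) (auto simp: measure_space_def)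
  have prob: "prob_space \<mu>"
    by (rule prob_spaceI) (use em[OF top] in \<open>simp add: sp f_S\<close>)
  interpret \<mu>: prob_space \<mu> by (rule prob)
  have sets': "sets \<mu> = sets (restrict_space borel (SigmaM M))"
    using sets sigma_sets_clopens[OF S] by (simp add: S_def)
  have s: "shift \<in> measurable \<mu> \<mu>" by (rule measurable_shift[OF sets'])
  \<comment> \<open>Clopen sets are stable under intersection and generate, so invariance on them
    extends to all Borel sets.\<close>
  have "\<mu> = distr \<mu> \<mu> shift"
  proof (rule measure_eqI_generator_eq[where E = "clopens S" and \<Omega> = S and A = "\<lambda>_. S"])
    fix X assume X: "X \<in> clopens S"
    then have "closed (shift -` X)" "closed (shift -` (S - X))"
      by (auto simp: clopens_def intro!: closed_vimage continuous_on_shift)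
    moreover have "S - shift -` X \<inter> S = shift -` (S - X) \<inter> S"
      by (auto simp: S_def shift_SigmaM)
    ultimately have "shift -` X \<inter> S \<in> clopens S" using S by (auto simp: clopens_def)
    moreover have "X \<in> sets \<mu>" using X by (auto simp: sets)
    ultimately show "emeasure \<mu> X = emeasure (distr \<mu> \<mu> shift) X"
      using X em f_shift by (simp add: emeasure_distr[OF s] sp)
  qed (use pow in \<open>auto simp: sets Int_stable_def\<close>)
  from inv_probsI[OF sets' prob this[symmetric]] have "\<mu> \<in> inv_probs M" .
  moreover have "emeasure \<mu> X = 0"
    if "X \<in> clopens (SigmaM M)" "(\<lambda>n. birkhoff_sum (indicator X) n (y n) / n) \<longlonglongrightarrow> 0" for X
    using em[of X] f_eq[of X 0] that by (simp add: S_def e_def)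
  ultimately show ?thesis by blast
qed

text \<open>A basic open set of the product topology restricts only finitely many coordinates;
  \<open>k\<close> exceeds all of them.\<close>

lemma open_contains_cylinder:
  fixes U :: "(nat \<Rightarrow> nat) set"
  assumes "open U" and "x \<in> U"
  obtains k where "\<And>y. (\<forall>j<k. y j = x j) \<Longrightarrow> y \<in> U"
proof -
  obtain X where X: "x \<in> PiE UNIV X" "finite {i. X i \<noteq> UNIV}" "PiE UNIV X \<subseteq> U"
    using product_topology_open_contains_basis[of "\<lambda>_. euclidean" UNIV U x] assms
    by (auto simp: euclidean_product_topology)
  then obtain k where k: "\<And>i. X i \<noteq> UNIV \<Longrightarrow> i < k"
    by (auto simp: finite_nat_set_iff_bounded)
  have "y \<in> U" if "\<forall>j<k. y j = x j" for y
  proof -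
    have "y i \<in> X i" for i
      using that k[of i] X(1) by (cases "X i = UNIV") (auto simp: PiE_UNIV_domain)
    then show ?thesis using X(3) by (auto simp: PiE_UNIV_domain)
  qed
  then show ?thesis by (rule that)
qed

lemma integral_funpow_shift_inv_probs:
  fixes g :: "(nat \<Rightarrow> nat) \<Rightarrow> real"
  assumes "\<mu> \<in> inv_probs M" and g: "continuous_on (SigmaM M) g" and "integrable \<mu> g"
  shows "integrable \<mu> (\<lambda>x. g ((shift ^^ n) x)) \<and> (\<integral>x. g ((shift ^^ n) x) \<partial>\<mu>) = (\<integral>x. g x \<partial>\<mu>)"
proof (induction n)
  case (Suc n)
  have "continuous_on (SigmaM M) (\<lambda>x. g ((shift ^^ n) x))"
    by (rule continuous_on_compose2[OF g continuous_on_funpow_shift]) (auto simp: funpow_shift_SigmaM)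
  from integral_shift_inv_probs[OF assms(1) this] Suc show ?case by (simp add: funpow_swap1)
qed (use assms in simp)

lemma integral_birkhoff_sum:
  assumes "\<mu> \<in> inv_probs M" and "continuous_on (SigmaM M) g" and "integrable \<mu> g"
  shows "integrable \<mu> (birkhoff_sum g n)" and "(\<integral>x. birkhoff_sum g n x \<partial>\<mu>) = n * (\<integral>x. g x \<partial>\<mu>)"
  using integral_funpow_shift_inv_probs[OF assms]
  unfolding birkhoff_sum_def[abs_def] by (simp_all add: Bochner_Integration.integral_sum)

section \<open>Sub-action and maximizing set of a coercive potential\<close>

locale coercive_potential =
  fixes M :: "nat \<Rightarrow> nat \<Rightarrow> bool" and F :: "nat set" and K0 :: nat
    and lam :: real and A :: "(nat \<Rightarrow> nat) \<Rightarrow> real" and H :: real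
  assumes finite_F: "finite F" and prim: "primitive_wrt M F K0"
    and nonempty: "SigmaM M \<noteq> {}"
    and lam: "0 < lam" "lam < 1"
    and bounded_above: "bounded_above_on (SigmaM M) A"
    and coercive: "coercive M A"
    and H_pos: "H > 0"
    and holder: "\<lbrakk>1 \<le> k; x \<in> SigmaM M; y \<in> SigmaM M; \<forall>j<k. x j = y j\<rbrakk> \<Longrightarrow> A x - A y \<le> H * lam ^ k"
begin

section \<open>Distortion, and finiteness of the maximal integral\<close>

definition D :: real where "D = H / (1 - lam)"

lemma D_nonneg: "D \<ge> 0"
  using H_pos lam by (simp add: D_def)

text \<open>After \<open>j\<close> steps the points still agree on \<open>n + k - j\<close>
  coordinates, at least \<open>k + 1\<close> of them. The Hoelder errors thus form a geometric
  series bounded independently of \<open>n\<close>, and \<open>k = 0\<close> is allowed although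
  \<open>holder\<close> starts at 1.\<close>

lemma birkhoff_sum_distortion:
  assumes "x \<in> SigmaM M" "y \<in> SigmaM M" "\<And>i. i < n + k \<Longrightarrow> x i = y i"
  shows "birkhoff_sum A n x - birkhoff_sum A n y \<le> D * lam ^ k"
proof -
  have "birkhoff_sum A n x - birkhoff_sum A n y = (\<Sum>j<n. A ((shift ^^ j) x) - A ((shift ^^ j) y))"
    by (simp add: birkhoff_sum_def sum_subtractf)
  also have "\<dots> \<le> (\<Sum>j<n. H * lam ^ (n + k - j))"
    using assms by (intro sum_mono holder funpow_shift_SigmaM allI impI) (auto simp: funpow_shift)
  also have "\<dots> = (\<Sum>j<n. H * lam ^ k * lam * lam ^ (n - Suc j))"
  proof (rule sum.cong)
    fix j assume "j \<in> {..<n}"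
    then have "n + k - j = k + Suc (n - Suc j)" by auto
    then show "H * lam ^ (n + k - j) = H * lam ^ k * lam * lam ^ (n - Suc j)"
      by (simp only: power_add power_Suc mult.assoc)
  qed simp
  also have "\<dots> = H * lam ^ k * (lam * (\<Sum>j<n. lam ^ j))"
    by (simp add: sum.nat_diff_reindex sum_distrib_left[symmetric] mult.assoc)
  also have "lam * (\<Sum>j<n. lam ^ j) \<le> 1 * (1 / (1 - lam))"
    using lam by (intro mult_mono sum_nonneg) (auto simp: sum_gp_strict divide_right_mono)
  finally show ?thesis using H_pos lam by (simp add: D_def mult_ac)
qed

lemma continuous_A: "continuous_on (SigmaM M) A"
  using continuous_on_SigmaM_if_holder[OF lam holder] .

text \<open>The Hoelder bound with \<open>k = 1\<close> bounds \<open>A\<close> below on each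
  cylinder of length one, and \<open>F\<close> selects finitely many of them. This limits the price
  of connecting words.\<close>

lemma A_bounded_below_F:
  obtains L where "L \<ge> 0" "\<And>x. \<lbrakk>x \<in> SigmaM M; x 0 \<in> F\<rbrakk> \<Longrightarrow> - L \<le> A x"
proof -
  have "\<forall>f\<in>F. \<exists>c. \<forall>x\<in>SigmaM M. x 0 = f \<longrightarrow> c \<le> A x"
  proof
    fix f
    show "\<exists>c. \<forall>x\<in>SigmaM M. x 0 = f \<longrightarrow> c \<le> A x"
    proof (cases "\<exists>y\<in>SigmaM M. y 0 = f")
      case True
      then obtain y where "y \<in> SigmaM M" "y 0 = f" by blast
      then have "\<forall>x\<in>SigmaM M. x 0 = f \<longrightarrow> A y - H * lam \<le> A x"
        using holder[of 1 y] by fastforce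
      then show ?thesis by blast
    qed auto
  qed
  then obtain c where c: "\<And>x. \<lbrakk>x \<in> SigmaM M; x 0 \<in> F\<rbrakk> \<Longrightarrow> c (x 0) \<le> A x"
    by metis
  show ?thesis
  \<comment> \<open>A sum instead of a maximum, so that an empty \<open>F\<close> needs no separate
    case.\<close>
  proof (rule that[of "\<Sum>f\<in>F. \<bar>c f\<bar>"])
    fix x assume x: "x \<in> SigmaM M" "x 0 \<in> F"
    have "\<bar>c (x 0)\<bar> \<le> (\<Sum>f\<in>F. \<bar>c f\<bar>)" using x finite_F by (intro member_le_sum) auto
    with c[OF x] show "- (\<Sum>f\<in>F. \<bar>c f\<bar>) \<le> A x" by linarith
  qed (simp add: sum_nonneg)
qed

definition b :: real where "b = real_of_ereal (beta M A)"

lemma periodic_orbit_integ: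
  assumes "z \<in> SigmaM M" "(shift ^^ p) z = z" "p > 0"
  shows "ereal (birkhoff_sum A p z / p) \<le> beta M A"
proof -
  obtain \<mu> where \<mu>: "\<mu> \<in> inv_probs M"
    "\<And>f :: _ \<Rightarrow> real. f \<in> borel_measurable \<mu> \<Longrightarrow> integrable \<mu> f \<and> (\<integral>x. f x \<partial>\<mu>) = birkhoff_sum f p z / p"
    using periodic_orbit_measure[OF assms] by blast
  have "integ \<mu> A = ereal (birkhoff_sum A p z / p)"
    using \<mu>(2)[OF borel_measurable_inv_probs[OF \<mu>(1) continuous_A]] by (simp add: integ_def)
  with \<mu>(1) show ?thesis by (auto simp: beta_def intro: SUP_upper2)
qed

text \<open>The upper bound of \<open>A\<close> bounds every integral, and the periodic orbit
  closing up one symbol of any point excludes minus infinity. So \<open>real_of_ereal\<close> in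
  \<open>b\<close> never falls back on its default value.\<close>

lemma beta_eq: "beta M A = ereal b"
proof -
  obtain C where C: "\<And>x. x \<in> SigmaM M \<Longrightarrow> A x \<le> C"
    using bounded_above by (auto simp: bounded_above_on_def)
  have "integ \<mu> A \<le> ereal C" if \<mu>: "\<mu> \<in> inv_probs M" for \<mu>
  proof -
    interpret prob_space \<mu> by (rule prob_space_inv_probs[OF \<mu>])
    show ?thesis
      using C space_inv_probs[OF \<mu>] by (auto simp: integ_def intro!: integral_le_const)
  qed
  then have "beta M A \<le> ereal C" unfolding beta_def by (rule SUP_least)
  moreover obtain x where x: "x \<in> SigmaM M" using nonempty by blast
  obtain z where "z \<in> SigmaM M" "(shift ^^ (1 + K0)) z = z"
    using SigmaM_periodic_closure[OF prim x, of 1] by auto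
  from periodic_orbit_integ[OF this] have "beta M A \<noteq> -\<infinity>" by auto
  ultimately show ?thesis unfolding b_def by (cases "beta M A") auto
qed

text \<open>Closing an orbit segment to a periodic orbit costs only a bounded amount, and periodic orbits
  cannot beat \<open>b\<close>.\<close>

lemma birkhoff_sum_le:
  obtains C where "C \<ge> 0" "\<And>n x. x \<in> SigmaM M \<Longrightarrow> birkhoff_sum A n x - n * b \<le> C"
proof -
  obtain L where L: "L \<ge> 0" "\<And>x. \<lbrakk>x \<in> SigmaM M; x 0 \<in> F\<rbrakk> \<Longrightarrow> - L \<le> A x"
    using A_bounded_below_F by blast
  \<comment> \<open>\<open>D\<close> pays for replacing \<open>x\<close> by the periodic point over
    \<open>n\<close> steps; the \<open>K0\<close> connecting steps cost at most \<open>L\<close>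
    each, plus the change from \<open>n * b\<close> to \<open>(n + K0) * b\<close>.\<close>
  define C where "C = D + K0 * (L + \<bar>b\<bar>)"
  have C: "C \<ge> 0" using D_nonneg L(1) by (simp add: C_def)
  have "birkhoff_sum A n x - n * b \<le> C" if x: "x \<in> SigmaM M" for n x
  proof (cases "n = 0")
    case True
    then show ?thesis using C by (simp add: birkhoff_sum_def)
  next
    case False
    then have "n \<ge> 1" by simp
    from SigmaM_periodic_closure[OF prim x this] obtain z where
      z: "z \<in> SigmaM M" "\<And>i. i < n \<Longrightarrow> z i = x i" "(shift ^^ (n + K0)) z = z"
         "\<And>i. n \<le> i \<Longrightarrow> i < n + K0 \<Longrightarrow> z i \<in> F" by metis
    have "birkhoff_sum A (n + K0) z / (n + K0) \<le> b"
      using periodic_orbit_integ[OF z(1,3)] \<open>n \<ge> 1\<close> by (simp add: beta_eq)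
    then have "birkhoff_sum A (n + K0) z \<le> (n + K0) * b"
      using \<open>n \<ge> 1\<close> by (simp add: divide_le_eq mult.commute)
    moreover have "birkhoff_sum A K0 ((shift ^^ n) z) \<ge> (\<Sum>j<K0. - L)"
      unfolding birkhoff_sum_def using z
      by (intro sum_mono L funpow_shift_SigmaM) (auto simp: funpow_shift)
    moreover have "birkhoff_sum A n x - birkhoff_sum A n z \<le> D * lam ^ 0"
      using z x by (intro birkhoff_sum_distortion) auto
    moreover have "K0 * b \<le> K0 * \<bar>b\<bar>" by (simp add: mult_left_mono)
    ultimately show ?thesis
      using birkhoff_sum_add[of A n K0 z] by (simp add: C_def algebra_simps)
  qed
  with C show ?thesis by (rule that)
qed

section \<open>The sub-action: bounds, cohomological inequality, regularity\<close>

definition sub_action :: "(nat \<Rightarrow> nat) \<Rightarrow> real" where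
  "sub_action x = (SUP (n, y) \<in> {(n, y). y \<in> SigmaM M \<and> (shift ^^ n) y = x}. birkhoff_sum A n y - n * b)"

lemma sub_action_upper:
  assumes "y \<in> SigmaM M" "(shift ^^ n) y = x"
  shows "birkhoff_sum A n y - n * b \<le> sub_action x"
proof -
  obtain C where "\<And>n x. x \<in> SigmaM M \<Longrightarrow> birkhoff_sum A n x - n * b \<le> C"
    using birkhoff_sum_le by blast
  then have "bdd_above ((\<lambda>(n, y). birkhoff_sum A n y - n * b) ` {(n, y). y \<in> SigmaM M \<and> (shift ^^ n) y = x})"
    by (auto intro!: bdd_aboveI[of _ C])
  from cSUP_upper[OF _ this, of "(n, y)"] assms show ?thesis by (simp add: sub_action_def)
qed

lemma sub_action_least:
  assumes "x \<in> SigmaM M"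
    and "\<And>n y. \<lbrakk>y \<in> SigmaM M; (shift ^^ n) y = x\<rbrakk> \<Longrightarrow> birkhoff_sum A n y - n * b \<le> c"
  shows "sub_action x \<le> c"
  unfolding sub_action_def
proof (rule cSUP_least)
  \<comment> \<open>The pair with \<open>n = 0\<close> keeps the index set nonempty; its value 0 is
    also what makes \<open>sub_action\<close> nonnegative.\<close>
  have "(0, x) \<in> {(n, y). y \<in> SigmaM M \<and> (shift ^^ n) y = x}" using assms(1) by simp
  then show "{(n, y). y \<in> SigmaM M \<and> (shift ^^ n) y = x} \<noteq> {}" by blast
qed (use assms(2) in auto)

lemma sub_action_bounded:
  obtains C where "C \<ge> 0" "\<And>x. x \<in> SigmaM M \<Longrightarrow> 0 \<le> sub_action x \<and> sub_action x \<le> C"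
proof -
  obtain C where C: "C \<ge> 0" "\<And>n x. x \<in> SigmaM M \<Longrightarrow> birkhoff_sum A n x - n * b \<le> C"
    using birkhoff_sum_le by blast
  have "0 \<le> sub_action x \<and> sub_action x \<le> C" if "x \<in> SigmaM M" for x
    using sub_action_upper[of x 0 x] sub_action_least[of x C] C that by (auto simp: birkhoff_sum_def)
  with C(1) show ?thesis by (rule that)
qed

text \<open>A preimage of \<open>x\<close> after \<open>n\<close> steps is a preimage of
  \<open>shift x\<close> after \<open>n + 1\<close> steps, with the additional term
  \<open>A x - b\<close>.\<close>

lemma sub_action_shift:
  assumes "x \<in> SigmaM M"
  shows "sub_action x + A x - b \<le> sub_action (shift x)"
proof -
  have "sub_action x \<le> sub_action (shift x) - A x + b"
  proof (rule sub_action_least[OF assms])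
    fix n y assume y: "y \<in> SigmaM M" "(shift ^^ n) y = x"
    then have "birkhoff_sum A (Suc n) y - Suc n * b \<le> sub_action (shift x)"
      by (intro sub_action_upper) auto
    then show "birkhoff_sum A n y - n * b \<le> sub_action (shift x) - A x + b"
      using y by (simp add: birkhoff_sum_def algebra_simps)
  qed
  then show ?thesis by simp
qed

text \<open>Backward branches can be exchanged: the \<open>n\<close> symbols preceding
  \<open>x\<close> in \<open>y\<close> can also precede \<open>x'\<close>, since
  \<open>k \<ge> 1\<close> gives both points the same first symbol. The Birkhoff sums then differ
  only by the distortion.\<close>

lemma sub_action_holder:
  assumes k: "1 \<le> k" and x: "x \<in> SigmaM M" and x': "x' \<in> SigmaM M" and eq: "\<forall>j<k. x j = x' j"
  shows "sub_action x - sub_action x' \<le> D * lam ^ k"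
proof -
  have "sub_action x \<le> sub_action x' + D * lam ^ k"
  proof (rule sub_action_least[OF x])
    fix n y assume y: "y \<in> SigmaM M" "(shift ^^ n) y = x"
    define y' where "y' i = (if i < n then y i else x' (i - n))" for i
    have yx: "y (i + n) = x i" for i using y(2) by (auto simp: funpow_shift)
    have agree: "y i = y' i" if "i < n + k" for i
      using that yx[of "i - n"] eq by (auto simp: y'_def)
    have "M (y' i) (y' (Suc i))" for i
    proof (cases "i < n")
      case True
      then have "y' i = y i" "y' (Suc i) = y (Suc i)" using agree k by auto
      then show ?thesis using y(1) by (simp add: SigmaM_def)
    next
      case False
      then show ?thesis using x' by (simp add: y'_def SigmaM_def Suc_diff_le)
    qed
    then have y': "y' \<in> SigmaM M" by (simp add: SigmaM_def)
    moreover have "(shift ^^ n) y' = x'" by (auto simp: funpow_shift y'_def)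
    ultimately have "birkhoff_sum A n y' - n * b \<le> sub_action x'" by (rule sub_action_upper)
    with birkhoff_sum_distortion[OF y(1) y' agree]
    show "birkhoff_sum A n y - n * b \<le> sub_action x' + D * lam ^ k" by fastforce
  qed
  then show ?thesis by simp
qed

lemma continuous_sub_action: "continuous_on (SigmaM M) sub_action"
  using continuous_on_SigmaM_if_holder[OF lam sub_action_holder] .

section \<open>The normalised potential and the maximizing set\<close>

definition B :: "(nat \<Rightarrow> nat) \<Rightarrow> real" where
  "B x = A x - b + (sub_action x - sub_action (shift x))"

lemma B_nonpos: "x \<in> SigmaM M \<Longrightarrow> B x \<le> 0"
  using sub_action_shift[of x] by (simp add: B_def)

lemma continuous_sub_action_shift: "continuous_on (SigmaM M) (\<lambda>x. sub_action (shift x))"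
  by (rule continuous_on_compose2[OF continuous_sub_action continuous_on_shift])
    (auto simp: shift_SigmaM)

lemma continuous_B: "continuous_on (SigmaM M) B"
  unfolding B_def[abs_def]
  by (intro continuous_intros continuous_A continuous_sub_action continuous_sub_action_shift)

lemma birkhoff_sum_B:
  "birkhoff_sum B n x = birkhoff_sum A n x - n * b + (sub_action x - sub_action ((shift ^^ n) x))"
  by (simp add: birkhoff_sum_coboundary[symmetric] birkhoff_sum_diff_const[symmetric])
    (simp add: birkhoff_sum_def B_def sum.distrib[symmetric])

text \<open>Boundedness makes \<open>sub_action\<close> integrable for every invariant probability,
  even one for which \<open>A\<close> is not integrable.\<close>

lemma integral_sub_action_coboundary:
  assumes \<mu>: "\<mu> \<in> inv_probs M"
  shows "integrable \<mu> (\<lambda>x. sub_action x - sub_action (shift x))"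
    and "(\<integral>x. sub_action x - sub_action (shift x) \<partial>\<mu>) = 0"
proof -
  interpret prob_space \<mu> by (rule prob_space_inv_probs[OF \<mu>])
  obtain C where "\<And>x. x \<in> SigmaM M \<Longrightarrow> 0 \<le> sub_action x \<and> sub_action x \<le> C"
    using sub_action_bounded by blast
  then have i: "integrable \<mu> sub_action"
    using space_inv_probs[OF \<mu>] borel_measurable_inv_probs[OF \<mu> continuous_sub_action]
    by (intro integrable_const_bound[of _ C]) auto
  note s = integral_shift_inv_probs[OF \<mu> continuous_sub_action]
  show "integrable \<mu> (\<lambda>x. sub_action x - sub_action (shift x))"
    "(\<integral>x. sub_action x - sub_action (shift x) \<partial>\<mu>) = 0"
    using i s by simp_all
qed

lemma maximizing_iff_AE:
  assumes \<mu>: "\<mu> \<in> inv_probs M"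
  shows "maximizing M A \<mu> \<longleftrightarrow> (AE x in \<mu>. B x = 0)"
proof -
  interpret prob_space \<mu> by (rule prob_space_inv_probs[OF \<mu>])
  note W = integral_sub_action_coboundary[OF \<mu>]
  show ?thesis
  proof
    assume "maximizing M A \<mu>"
    then have "integ \<mu> A = ereal b" by (simp add: maximizing_def beta_eq)
    then have A: "integrable \<mu> A" "(\<integral>x. A x \<partial>\<mu>) = b"
      by (auto simp: integ_def split: if_splits)
    then have "integrable \<mu> (\<lambda>x. A x - b)" "(\<integral>x. A x - b \<partial>\<mu>) = 0"
      by (simp_all add: prob_space)
    from Bochner_Integration.integrable_add[OF this(1) W(1)]
      Bochner_Integration.integral_add[OF this(1) W(1)] this(2) W(2)
    have "integrable \<mu> B" "(\<integral>x. B x \<partial>\<mu>) = 0"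
      by (simp_all only: B_def[abs_def] add_0)
    then have "integrable \<mu> (\<lambda>x. - B x)" "(\<integral>x. - B x \<partial>\<mu>) = 0"
      by simp_all
    moreover have "AE x in \<mu>. 0 \<le> - B x"
      using B_nonpos space_inv_probs[OF \<mu>] by auto
    ultimately show "AE x in \<mu>. B x = 0"
      using integral_nonneg_eq_0_iff_AE[of \<mu> "\<lambda>x. - B x"] by simp
  next
    assume "AE x in \<mu>. B x = 0"
    \<comment> \<open>\<open>A\<close> agrees almost everywhere with an integrable function, so
      \<open>integ\<close> is the integral and not the default minus infinity.\<close>
    then have AE: "AE x in \<mu>. A x = b - (sub_action x - sub_action (shift x))"
      by eventually_elim (simp add: B_def)
    have meas: "A \<in> borel_measurable \<mu>"
      "(\<lambda>x. b - (sub_action x - sub_action (shift x))) \<in> borel_measurable \<mu>"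
      using borel_measurable_inv_probs[OF \<mu> continuous_A] W(1) by auto
    have "integrable \<mu> A"
      using integrable_cong_AE[OF meas AE] W(1) by simp
    moreover have "(\<integral>x. A x \<partial>\<mu>) = b"
      using integral_cong_AE[OF meas AE] W by (simp add: prob_space)
    ultimately show "maximizing M A \<mu>"
      using \<mu> by (simp add: maximizing_def integ_def beta_eq)
  qed
qed

text \<open>\<open>B x = 0\<close> restrains only the symbol \<open>x 0\<close>; imposed along the
  forward orbit it bounds all symbols, and the set becomes forward invariant.\<close>

definition Omega :: "(nat \<Rightarrow> nat) set" where
  "Omega = {x \<in> SigmaM M. \<forall>n. B ((shift ^^ n) x) = 0}"

lemma maximizing_iff_supp:
  assumes \<mu>: "\<mu> \<in> inv_probs M"
  shows "maximizing M A \<mu> \<longleftrightarrow> supp \<mu> \<subseteq> Omega"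
proof
  assume "maximizing M A \<mu>"
  then have AE: "AE x in \<mu>. B x = 0" by (simp add: maximizing_iff_AE[OF \<mu>])
  have cont: "continuous_on (SigmaM M) (\<lambda>x. B ((shift ^^ n) x))" for n
    by (rule continuous_on_compose2[OF continuous_B continuous_on_funpow_shift])
      (auto simp: funpow_shift_SigmaM)
  have "\<forall>x\<in>supp \<mu>. B ((shift ^^ n) x) = 0" for n
    using AE_zero_iff_supp[OF \<mu> cont] AE_funpow_shift[OF \<mu> continuous_B AE] by blast
  then show "supp \<mu> \<subseteq> Omega"
    using space_inv_probs[OF \<mu>] by (auto simp: Omega_def supp_def)
next
  assume "supp \<mu> \<subseteq> Omega"
  then have "\<forall>x\<in>supp \<mu>. B ((shift ^^ 0) x) = 0" unfolding Omega_def by blast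
  then show "maximizing M A \<mu>"
    using AE_zero_iff_supp[OF \<mu> continuous_B] by (simp add: maximizing_iff_AE[OF \<mu>])
qed

lemma B_bounded_below_imp:
  obtains N where "\<And>x. \<lbrakk>x \<in> SigmaM M; - c \<le> B x\<rbrakk> \<Longrightarrow> x 0 < N"
proof -
  obtain C where C: "\<And>x. x \<in> SigmaM M \<Longrightarrow> 0 \<le> sub_action x \<and> sub_action x \<le> C"
    using sub_action_bounded by blast
  \<comment> \<open>\<open>C\<close> absorbs the coboundary in \<open>B\<close>; the extra 1 makes
    the contradiction strict.\<close>
  obtain N where N: "\<And>x. \<lbrakk>x 0 \<ge> N; x \<in> SigmaM M\<rbrakk> \<Longrightarrow> A x \<le> b - c - C - 1"
    using coercive unfolding coercive_def by metis
  have "x 0 < N" if "x \<in> SigmaM M" "- c \<le> B x" for x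
  proof (rule ccontr)
    assume "\<not> x 0 < N"
    with N[of x] that(1) have "A x \<le> b - c - C - 1" by simp
    with that C[of x] C[OF shift_SigmaM, of x] show False by (simp add: B_def)
  qed
  then show ?thesis by (rule that)
qed

lemma Omega_subset_SigmaI: obtains N where "Omega \<subseteq> SigmaI M N"
proof -
  obtain N where N: "\<And>x. \<lbrakk>x \<in> SigmaM M; - 0 \<le> B x\<rbrakk> \<Longrightarrow> x 0 < N"
    using B_bounded_below_imp by blast
  have "x j \<le> N" if "x \<in> Omega" for x j
  proof -
    have "(shift ^^ j) x 0 < N" using that by (intro N funpow_shift_SigmaM) (simp_all add: Omega_def)
    then show ?thesis by (simp add: funpow_shift)
  qed
  then have "Omega \<subseteq> SigmaI M N" by (auto simp: SigmaI_def Omega_def)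
  then show ?thesis by (rule that)
qed

lemma compact_Omega: "compact Omega"
proof -
  obtain N where N: "Omega \<subseteq> SigmaI M N" by (rule Omega_subset_SigmaI)
  have "Omega = (\<Inter>n. {x \<in> SigmaM M. (\<lambda>x. B ((shift ^^ n) x)) x = 0})"
    by (auto simp: Omega_def)
  moreover have "closed {x \<in> SigmaM M. (\<lambda>x. B ((shift ^^ n) x)) x = 0}" for n
    by (intro continuous_closed_preimage_constant closed_SigmaM
        continuous_on_compose2[OF continuous_B continuous_on_funpow_shift])
      (auto simp: funpow_shift_SigmaM)
  ultimately have "closed Omega" by auto
  from closed_Int_compact[OF this compact_SigmaI] N show ?thesis by (metis Int_absorb2)
qed

lemma shift_Omega: "shift ` Omega \<subseteq> Omega"
proof (intro image_subsetI)
  fix x assume x: "x \<in> Omega"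
  then have "B ((shift ^^ Suc n) x) = 0" for n unfolding Omega_def by blast
  then have "B ((shift ^^ n) (shift x)) = 0" for n by (simp only: funpow_Suc_right comp_apply)
  with x show "shift x \<in> Omega" by (simp add: Omega_def shift_SigmaM)
qed

section \<open>Existence of a maximizing probability\<close>

lemma birkhoff_sum_near_optimal: "\<exists>y\<in>SigmaM M. birkhoff_sum A (Suc n) y \<ge> Suc n * b - 2"
proof (rule ccontr)
  assume *: "\<not> ?thesis"
  \<comment> \<open>An error below \<open>1 / Suc n\<close> in the integral becomes less than 1
    after multiplication by \<open>Suc n\<close>, too little for the deficit 2 that the negated
    claim forces at every point.\<close>
  have "ereal (b - 1 / Suc n) < beta M A" by (simp add: beta_eq)
  then obtain \<mu> where \<mu>: "\<mu> \<in> inv_probs M" "ereal (b - 1 / Suc n) < integ \<mu> A"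
    unfolding beta_def by (auto simp: less_SUP_iff)
  then have A: "integrable \<mu> A" "b - 1 / Suc n < (\<integral>x. A x \<partial>\<mu>)"
    by (auto simp: integ_def split: if_splits)
  interpret prob_space \<mu> by (rule prob_space_inv_probs[OF \<mu>(1)])
  have "(\<integral>x. birkhoff_sum A (Suc n) x \<partial>\<mu>) \<le> Suc n * b - 2"
    using * space_inv_probs[OF \<mu>(1)]
    by (intro integral_le_const integral_birkhoff_sum[OF \<mu>(1) continuous_A A(1)]) fastforce
  then have "Suc n * (\<integral>x. A x \<partial>\<mu>) \<le> Suc n * b - 2"
    by (simp only: integral_birkhoff_sum[OF \<mu>(1) continuous_A A(1)])
  moreover have "Suc n * (b - 1 / Suc n) < Suc n * (\<integral>x. A x \<partial>\<mu>)"
    using A(2) by (intro mult_strict_left_mono) auto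
  moreover have "Suc n * (b - 1 / Suc n) = Suc n * b - 1"
    by (simp add: right_diff_distrib del: of_nat_Suc)
  ultimately show False by linarith
qed

text \<open>Since \<open>B \<le> 0\<close>, an almost optimal orbit segment has \<open>B\<close> bounded below at each
  of its points, and by coercivity this confines its symbols to a fixed finite set.\<close>

lemma almost_optimal_orbits:
  obtains c N where "\<And>n. \<exists>z\<in>SigmaI M N. - c \<le> birkhoff_sum B n z"
proof -
  obtain C where C: "C \<ge> 0" "\<And>x. x \<in> SigmaM M \<Longrightarrow> 0 \<le> sub_action x \<and> sub_action x \<le> C"
    using sub_action_bounded by blast
  \<comment> \<open>2 is the deficit of the near-optimal segment, \<open>D\<close> the price of
    replacing it by a periodic orbit, \<open>C\<close> the bound on the coboundary.\<close>
  define c where "c = 2 + D + C"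
  obtain N0 where N0: "\<And>x. \<lbrakk>x \<in> SigmaM M; - c \<le> B x\<rbrakk> \<Longrightarrow> x 0 < N0"
    using B_bounded_below_imp by blast
  obtain N1 where N1: "\<And>f. f \<in> F \<Longrightarrow> f < N1"
    using finite_F[unfolded finite_nat_set_iff_bounded] by blast
  define N where "N = max N0 N1"
  have "\<exists>z\<in>SigmaI M N. - c \<le> birkhoff_sum B n z" for n
  proof -
    obtain y where y: "y \<in> SigmaM M" "birkhoff_sum A (Suc n) y \<ge> Suc n * b - 2"
      using birkhoff_sum_near_optimal by blast
    \<comment> \<open>Only the first \<open>Suc n\<close> symbols can be controlled through
      \<open>B\<close>; closing up replaces the tail of \<open>y\<close> by symbols of
      \<open>F\<close> and repetitions.\<close>
    have "1 \<le> Suc n" by simp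
    from SigmaM_periodic_closure[OF prim y(1) this] obtain z where
      z: "z \<in> SigmaM M" "\<And>i. i < Suc n \<Longrightarrow> z i = y i" "(shift ^^ (Suc n + K0)) z = z"
         "\<And>i. Suc n \<le> i \<Longrightarrow> i < Suc n + K0 \<Longrightarrow> z i \<in> F" by metis
    have "birkhoff_sum A (Suc n) y - birkhoff_sum A (Suc n) z \<le> D * lam ^ 0"
      using z y by (intro birkhoff_sum_distortion) auto
    then have Bz: "- c \<le> birkhoff_sum B (Suc n) z"
      unfolding birkhoff_sum_B c_def
      using y(2) C(2)[OF z(1)] C(2)[OF funpow_shift_SigmaM[OF z(1)], of "Suc n"] by simp
    have nonpos: "B ((shift ^^ i) z) \<le> 0" for i
      by (intro B_nonpos funpow_shift_SigmaM z)
    have low: "z i < N0" if "i < Suc n" for i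
    proof -
      have "- B ((shift ^^ i) z) \<le> (\<Sum>j<Suc n. - B ((shift ^^ j) z))"
        using nonpos that by (intro member_le_sum) auto
      with Bz have "- c \<le> B ((shift ^^ i) z)"
        by (simp add: birkhoff_sum_def sum_negf)
      from N0[OF funpow_shift_SigmaM[OF z(1)] this] show ?thesis by (simp add: funpow_shift)
    qed
    have "z i \<le> N" for i
    proof (induction i rule: less_induct)
      case (less i)
      consider "i < Suc n" | "Suc n \<le> i" "i < Suc n + K0" | "i \<ge> Suc n + K0" by linarith
      then show ?case
      proof cases
        case 3
        have "z (i - (Suc n + K0) + (Suc n + K0)) = z (i - (Suc n + K0))"
          using fun_cong[OF z(3), of "i - (Suc n + K0)"] by (simp only: funpow_shift)
        then show ?thesis using less[of "i - (Suc n + K0)"] 3 by simp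
      qed (use low N1 z(4) in \<open>force simp: N_def\<close>)+
    qed
    then have "z \<in> SigmaI M N" using z(1) by (simp add: SigmaI_def)
    \<comment> \<open>Dropping the last, nonpositive term cannot lower the sum; \<open>Suc n\<close>
      only ensured a segment of positive length.\<close>
    moreover have "- c \<le> birkhoff_sum B n z"
      using Bz nonpos[of n] by (simp add: birkhoff_sum_def)
    ultimately show ?thesis by blast
  qed
  then show ?thesis by (rule that)
qed

text \<open>The total deficit stays below \<open>c\<close> while frequencies are divided by
  \<open>n\<close>. So a cylinder on which \<open>B\<close> is below a negative constant has limit
  frequency 0 and contains no point of the support.\<close>

lemma maximizing_exists: obtains \<mu> where "maximizing M A \<mu>"
proof -
  obtain c N where "\<And>n. \<exists>z\<in>SigmaI M N. - c \<le> birkhoff_sum B n z"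
    using almost_optimal_orbits by blast
  then obtain y where y: "\<And>n. y n \<in> SigmaI M N" "\<And>n. - c \<le> birkhoff_sum B n (y n)"
    by metis
  obtain \<mu> where \<mu>: "\<mu> \<in> inv_probs M"
    and null: "\<forall>X\<in>clopens (SigmaM M). (\<lambda>n. birkhoff_sum (indicator X) n (y n) / n) \<longlonglongrightarrow> 0
       \<longrightarrow> emeasure \<mu> X = 0"
    using krylov_bogolyubov[of y, OF y(1)] by (elim bexE) (rule that)
  have "B x = 0" if x: "x \<in> supp \<mu>" for x
  proof (rule ccontr)
    assume "B x \<noteq> 0"
    have xS: "x \<in> SigmaM M" using x space_inv_probs[OF \<mu>] by (simp add: supp_def)
    define \<epsilon> where "\<epsilon> = - B x / 2"
    have \<epsilon>: "\<epsilon> > 0" "B x < - \<epsilon>" using B_nonpos[OF xS] \<open>B x \<noteq> 0\<close> by (simp_all add: \<epsilon>_def)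
    obtain U where U: "open U" "U \<inter> SigmaM M = B -` {..<- \<epsilon>} \<inter> SigmaM M"
      using continuous_B[unfolded continuous_on_open_invariant, rule_format, of "{..<- \<epsilon>}"] by auto
    have "x \<in> U" using U(2) xS \<epsilon>(2) by auto
    \<comment> \<open>The neighbourhood is shrunk to a cylinder because the limit measure is
      controlled on clopen sets only.\<close>
    with U(1) obtain k where k: "\<And>y. (\<forall>j<k. y j = x j) \<Longrightarrow> y \<in> U"
      using open_contains_cylinder by blast
    define X where "X = {y \<in> SigmaM M. \<forall>j<k. y j = x j}"
    \<comment> \<open>Pointwise Markov inequality for \<open>- B\<close>; summed along an orbit it
      bounds the number of visits to \<open>X\<close> by \<open>c / \<epsilon>\<close>.\<close>
    have X: "indicator X w \<le> - B w / \<epsilon>" if "w \<in> SigmaM M" for w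
    proof (cases "w \<in> X")
      case True
      then have "w \<in> U \<inter> SigmaM M" using k by (simp add: X_def)
      then show ?thesis using U(2) True \<epsilon>(1) by (simp add: divide_le_eq)
    next
      case False
      then show ?thesis using B_nonpos[OF that] \<epsilon>(1) by (simp add: divide_le_eq)
    qed
    have "birkhoff_sum (indicator X) n (y n) / n \<le> (c / \<epsilon>) * (1 / n)" for n
    proof -
      have "y n \<in> SigmaM M" using y(1) by (simp add: SigmaI_def)
      then have "birkhoff_sum (indicator X) n (y n) \<le> (\<Sum>j<n. - B ((shift ^^ j) (y n)) / \<epsilon>)"
        unfolding birkhoff_sum_def by (intro sum_mono X funpow_shift_SigmaM)
      also have "\<dots> = - birkhoff_sum B n (y n) / \<epsilon>"
        by (simp add: birkhoff_sum_def sum_negf sum_divide_distrib)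
      also have "\<dots> \<le> c / \<epsilon>" using y(2)[of n] \<epsilon>(1) by (intro divide_right_mono) auto
      finally have "birkhoff_sum (indicator X) n (y n) \<le> c / \<epsilon>" .
      from divide_right_mono[OF this, of "real n"] show ?thesis by simp
    qed
    then have bound: "\<forall>\<^sub>F n in sequentially. norm (birkhoff_sum (indicator X) n (y n) / n) \<le> (c / \<epsilon>) * (1 / n)"
      using birkhoff_sum_indicator_bounds(1)[of X] by simp
    have "(\<lambda>n. (c / \<epsilon>) * (1 / real n)) \<longlonglongrightarrow> (c / \<epsilon>) * 0"
      by (intro tendsto_intros lim_1_over_n)
    then have "(\<lambda>n. (c / \<epsilon>) * (1 / real n)) \<longlonglongrightarrow> 0" by (simp only: mult_zero_right)
    from Lim_null_comparison[OF bound this]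
    have "(\<lambda>n. birkhoff_sum (indicator X) n (y n) / n) \<longlonglongrightarrow> 0" .
    moreover have "X \<in> clopens (SigmaM M)"
      unfolding X_def by (intro clopens_cylinder closed_SigmaM)
    ultimately have "emeasure \<mu> X = 0" using null by blast
    moreover have "X = {y. \<forall>j<k. y j = x j} \<inter> space \<mu>"
      using space_inv_probs[OF \<mu>] by (auto simp: X_def)
    moreover have "emeasure \<mu> ({y. \<forall>j<k. y j = x j} \<inter> space \<mu>) > 0"
      using x open_cylinder[of k x] by (simp add: supp_def)
    ultimately show False by simp
  qed
  then have "AE x in \<mu>. B x = 0" using AE_zero_iff_supp[OF \<mu> continuous_B] by blast
  with maximizing_iff_AE[OF \<mu>] show ?thesis by (intro that) simp
qed

end

theorem mainTheorem1:
  fixes M :: "nat \<Rightarrow> nat \<Rightarrow> bool" and F :: "nat set" and K0 :: nat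
    and lam :: real and A :: "(nat \<Rightarrow> nat) \<Rightarrow> real"
  assumes "finite F" and "primitive_wrt M F K0"
    and "SigmaM M \<noteq> {}"
    and "0 < lam" and "lam < 1"
    and "bounded_above_on (SigmaM M) A"
    and "continuous_on (SigmaM M) A"
    and "coercive M A"
    and "loc_holder M lam A"
  shows "\<exists>I::nat. (\<forall>f \<in> F. f < I) \<and>
           (\<exists>\<mu> \<in> inv_probs M. supp \<mu> \<subseteq> SigmaI M I \<and> integ \<mu> A = beta M A) \<and>
           (\<exists>\<mu>. maximizing M A \<mu>) \<and>
           (\<exists>\<Omega>. compact \<Omega> \<and> shift ` \<Omega> \<subseteq> \<Omega> \<and> \<Omega> \<subseteq> SigmaI M I \<and>
              (\<forall>\<mu> \<in> inv_probs M. maximizing M A \<mu> \<longleftrightarrow> supp \<mu> \<subseteq> \<Omega>))"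
proof -
  obtain H where H: "H > 0" "\<forall>k \<ge> 1. \<forall>x \<in> SigmaM M. \<forall>y \<in> SigmaM M.
      (\<forall>j < k. x j = y j) \<longrightarrow> A x - A y \<le> H * lam ^ k"
    using assms(9) unfolding loc_holder_def by blast
  interpret coercive_potential M F K0 lam A H
    using assms H by unfold_locales auto
  obtain N where N: "Omega \<subseteq> SigmaI M N" by (rule Omega_subset_SigmaI)
  obtain N' where N': "\<And>f. f \<in> F \<Longrightarrow> f < N'"
    using finite_F[unfolded finite_nat_set_iff_bounded] by blast
  \<comment> \<open>\<open>N\<close> accommodates \<open>Omega\<close>, while \<open>N'\<close> lies
    strictly above every element of \<open>F\<close>.\<close>
  define I where "I = max N N'"
  have "SigmaI M N \<subseteq> SigmaI M I" by (auto simp: SigmaI_def I_def le_max_iff_disj)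
  with N have Omega: "Omega \<subseteq> SigmaI M I" by simp
  obtain \<mu> where \<mu>: "maximizing M A \<mu>" by (rule maximizing_exists)
  then have \<mu>_inv: "\<mu> \<in> inv_probs M" and \<mu>_beta: "integ \<mu> A = beta M A"
    by (simp_all add: maximizing_def)
  have "supp \<mu> \<subseteq> SigmaI M I" using \<mu> Omega maximizing_iff_supp[OF \<mu>_inv] by blast
  moreover have "\<forall>f\<in>F. f < I" using N' by (auto simp: I_def less_max_iff_disj)
  ultimately show ?thesis
    using \<mu> \<mu>_inv \<mu>_beta Omega compact_Omega shift_Omega maximizing_iff_supp by metis
qed

end
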